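(* Let $p>7$ be a prime and let $d$ be any integer with $\left(\frac{d}{p}\right)=1$. Let $$T_{(p-11)/2}(d,p)=\det\left[(i^2+dj^2)^{(p-11)/2}\left(\frac{i^2+dj^2}{p}\right)\right]_{1\le i,j\le (p-1)/2}.$$ If $\left(\frac{T_{(p-11)/2}(d,p)}{p}\right)=-1$, then $p\equiv 1$, $2$ or $4\pmod 7$.
   Context: $\left(\frac{\cdot}{p}\right)$ denotes the Legendre symbol modulo $p$ (equal to $0$ on multiples of $p$). *)

theory Defs
  imports "Jordan_Normal_Form.Determinant" "HOL-Number_Theory.Quadratic_Reciprocity"
begin

(* The matrix constructor numbers rows and columns from 0, hence the shift to 1, ..., (p-1)/2. *)
definition T :: "nat \<Rightarrow> int \<Rightarrow> nat \<Rightarrow> int" where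
  "T n d p = det (mat ((p - 1) div 2) ((p - 1) div 2)
     (\<lambda>(r, s). let i = int r + 1; j = int s + 1 in
        (i\<^sup>2 + d * j\<^sup>2) ^ n * Legendre (i\<^sup>2 + d * j\<^sup>2) (int p)))"

end

theory Submission
  imports Defs
begin

text \<open>
  Put \<open>n = (p - 1) / 2\<close> and \<open>m = p - 6\<close>. By Euler's criterion the matrix is congruent modulo \<open>p\<close> to
  \<open>(x\<^sub>i + d x\<^sub>j)\<^sup>m\<close> with \<open>x\<^sub>i = i\<^sup>2\<close> an \<open>n\<close>-th root of unity, so that it factors through the
  Vandermonde matrix of the \<open>x\<^sub>i\<close>, a diagonal matrix with entries \<open>c\<^sub>k = C(m, k) + C(m, n + k)\<close>, and the
  row-reversed transpose of the same Vandermonde matrix. Up to squares the determinant is therefore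
  \<open>(-1)\<close> to the \<open>n div 2\<close> times the product of the \<open>c\<^sub>k\<close>. The symmetry of the binomial coefficients
  pairs the \<open>c\<^sub>k\<close> into squares, except for the middle one when \<open>n\<close> is odd, which equals
  \<open>\<plusminus>63 / 2\<^sup>1\<^sup>2\<close> modulo \<open>p\<close>. For even \<open>n\<close> the determinant is thus always a square modulo \<open>p\<close>, and for odd \<open>n\<close>
  it is a square times 7, which quadratic reciprocity decides.
\<close>

text \<open>Each of 8, 9, 10 is divisible by 2 or 3. The bound makes \<open>p - 11\<close> a genuine
  subtraction of naturals.\<close>

lemma prime_gt_7_ge_11:
  assumes "prime (p::nat)" "p > 7"
  shows "p \<ge> 11"
proof (rule ccontr)
  assume "\<not> p \<ge> 11"
  then have "2 dvd p \<or> 3 dvd p" using assms(2) by presburger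
  then show False
    using primes_dvd_imp_eq[of 2 p] primes_dvd_imp_eq[of 3 p] assms by auto
qed

section \<open>Squares modulo \<open>p\<close>\<close>

lemma QuadRes_cong:
  assumes "[a = b] (mod p)" "QuadRes p a"
  shows "QuadRes p b"
  using assms unfolding QuadRes_def by (meson cong_trans)

text \<open>\<open>QuadRes\<close> counts 0 as a square, so factors of the determinant may vanish
  modulo \<open>p\<close>.\<close>

lemma QuadRes_mult:
  assumes "QuadRes p a" "QuadRes p b"
  shows "QuadRes p (a * b)"
proof -
  obtain y z where "[y^2 = a] (mod p)" "[z^2 = b] (mod p)"
    using assms unfolding QuadRes_def by blast
  then have "[(y * z)^2 = a * b] (mod p)"
    using cong_mult power_mult_distrib by metis
  then show ?thesis unfolding QuadRes_def by blast
qed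

lemma QuadRes_power2: "QuadRes p (a^2)"
  unfolding QuadRes_def by (blast intro: cong_refl)

lemma QuadRes_power:
  assumes "QuadRes p a"
  shows "QuadRes p (a ^ k)"
proof (induction k)
  case 0
  show ?case using QuadRes_power2[of p 1] by simp
qed (simp add: QuadRes_mult assms)

lemma QuadRes_prod:
  assumes "\<And>i. i \<in> I \<Longrightarrow> QuadRes p (f i)"
  shows "QuadRes p (\<Prod>i\<in>I. f i)"
  using assms
proof (induction I rule: infinite_finite_induct)
  case (insert i I)
  then show ?case by (simp add: QuadRes_mult)
qed (use QuadRes_power2[of p 1] in simp_all)

text \<open>Multiply by the square of an inverse of \<open>b\<close>. This later removes a power of
  2.\<close>

lemma QuadRes_cancel_power2:
  assumes "coprime b p" "QuadRes p (b^2 * a)"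
  shows "QuadRes p a"
proof -
  obtain u where u: "[b * u = 1] (mod p)"
    using cong_solve_coprime_int[OF assms(1)] by blast
  have "[(b * u)^2 * a = 1^2 * a] (mod p)"
    by (intro cong_mult cong_pow u cong_refl)
  moreover have "QuadRes p ((b * u)^2 * a)"
    using QuadRes_mult[OF QuadRes_power2[of p u] assms(2)]
    by (simp add: power_mult_distrib mult_ac)
  ultimately show ?thesis using QuadRes_cong by fastforce
qed

section \<open>Determinants: congruence, scaling, factorization and row reversal\<close>

text \<open>By the Leibniz formula the determinant is an integer polynomial in the entries.\<close>

lemma det_cong:
  fixes f g :: "nat \<Rightarrow> nat \<Rightarrow> int"
  assumes "\<And>i j. i < n \<Longrightarrow> j < n \<Longrightarrow> [f i j = g i j] (mod q)"
  shows "[det (mat n n (\<lambda>(i, j). f i j)) = det (mat n n (\<lambda>(i, j). g i j))] (mod q)"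
proof -
  have "[(\<Sum>\<pi> | \<pi> permutes {0..<n}. signof \<pi> * (\<Prod>i = 0..<n. f i (\<pi> i))) =
         (\<Sum>\<pi> | \<pi> permutes {0..<n}. signof \<pi> * (\<Prod>i = 0..<n. g i (\<pi> i)))] (mod q)"
    by (intro cong_sum cong_mult cong_refl cong_prod assms)
       (auto simp: permutes_in_image)
  moreover have "(\<Sum>\<pi> | \<pi> permutes {0..<n}. signof \<pi> * (\<Prod>i = 0..<n. h i (\<pi> i)))
      = det (mat n n (\<lambda>(i, j). h i j))" for h :: "nat \<Rightarrow> nat \<Rightarrow> int"
    unfolding det_def'[OF mat_carrier]
    by (intro sum.cong refl arg_cong2[where f = "(*)"] prod.cong)
       (auto simp: permutes_in_image)
  ultimately show ?thesis by simp
qed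

text \<open>A permutation meets every row and every column once, so all Leibniz terms share the same
  factor.\<close>

lemma det_scale_rows_cols:
  fixes f :: "nat \<Rightarrow> nat \<Rightarrow> 'a :: comm_ring_1"
  shows "det (mat n n (\<lambda>(i, j). r i * f i j * s j)) =
    (\<Prod>i<n. r i) * (\<Prod>j<n. s j) * det (mat n n (\<lambda>(i, j). f i j))"
proof -
  have *: "(\<Prod>i = 0..<n. r i * f i (\<pi> i) * s (\<pi> i)) =
      (\<Prod>i<n. r i) * (\<Prod>j<n. s j) * (\<Prod>i = 0..<n. f i (\<pi> i))"
    if "\<pi> permutes {0..<n}" for \<pi>
    using prod.permute[OF that, of s]
    by (simp add: prod.distrib lessThan_atLeast0 o_def mult_ac)
  have "det (mat n n (\<lambda>(i, j). r i * f i j * s j)) =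
      (\<Sum>\<pi> | \<pi> permutes {0..<n}. signof \<pi> * (\<Prod>i = 0..<n. r i * f i (\<pi> i) * s (\<pi> i)))"
    unfolding det_def'[OF mat_carrier]
    by (intro sum.cong refl arg_cong2[where f = "(*)"] prod.cong)
       (auto simp: permutes_in_image)
  also have "\<dots> = (\<Sum>\<pi> | \<pi> permutes {0..<n}. (\<Prod>i<n. r i) * (\<Prod>j<n. s j) *
      (signof \<pi> * (\<Prod>i = 0..<n. f i (\<pi> i))))"
    by (intro sum.cong refl) (subst *, simp, simp add: mult_ac)
  also have "\<dots> = (\<Prod>i<n. r i) * (\<Prod>j<n. s j) *
      (\<Sum>\<pi> | \<pi> permutes {0..<n}. signof \<pi> * (\<Prod>i = 0..<n. f i (\<pi> i)))"
    by (simp add: sum_distrib_left)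
  also have "(\<Sum>\<pi> | \<pi> permutes {0..<n}. signof \<pi> * (\<Prod>i = 0..<n. f i (\<pi> i)))
      = det (mat n n (\<lambda>(i, j). f i j))"
    unfolding det_def'[OF mat_carrier]
    by (intro sum.cong refl arg_cong2[where f = "(*)"] prod.cong)
       (auto simp: permutes_in_image)
  finally show ?thesis .
qed

lemma det_sum_mult:
  fixes f g :: "nat \<Rightarrow> nat \<Rightarrow> 'a :: comm_ring_1"
  shows "det (mat n n (\<lambda>(i, j). \<Sum>k<n. f i k * g k j)) =
    det (mat n n (\<lambda>(i, j). f i j)) * det (mat n n (\<lambda>(i, j). g i j))"
proof -
  have "mat n n (\<lambda>(i, j). \<Sum>k<n. f i k * g k j) =
      mat n n (\<lambda>(i, j). f i j) * mat n n (\<lambda>(i, j). g i j)"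
    by (intro eq_matI) (auto simp: scalar_prod_def lessThan_atLeast0)
  then show ?thesis by (simp add: det_mult[of _ n])
qed

text \<open>The reversal of \<open>{0..<n}\<close> is built up by exchanging the outermost \<open>k\<close> pairs.\<close>

lemma sign_partial_reversal:
  assumes "2 * k \<le> n"
  defines "g \<equiv> (\<lambda>k i. if i < n \<and> (i < k \<or> n - 1 - i < k) then n - 1 - i else i)"
  shows "g k permutes {0..<n} \<and> sign (g k) = (-1) ^ k"
  using assms(1)
proof (induction k)
  case 0
  have "g 0 = id" by (auto simp: g_def)
  then show ?case using permutes_id[of "{0..<n}"] by (simp only: sign_id power_0 simp_thms)
next
  case (Suc k)
  then have IH: "g k permutes {0..<n}" "sign (g k) = (-1) ^ k" by auto
  have kn: "k < n" "n - 1 - k < n" "k \<noteq> n - 1 - k" using Suc.prems by auto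
  have tr: "Transposition.transpose k (n - 1 - k) permutes {0..<n}"
    using kn by (intro permutes_swap_id) auto
  \<comment> \<open>\<open>g k\<close> fixes both \<open>k\<close> and \<open>n - 1 - k\<close>
    because \<open>2 * Suc k \<le> n\<close>, so the transposition just adds one exchanged
    pair.\<close>
  have eq: "g (Suc k) = Transposition.transpose k (n - 1 - k) \<circ> g k"
    using Suc.prems by (auto simp: fun_eq_iff g_def Transposition.transpose_def)
  have "permutation (Transposition.transpose k (n - 1 - k))" "permutation (g k)"
    using tr IH(1) by (auto intro: permutes_imp_permutation)
  then have "sign (g (Suc k)) = (-1) ^ Suc k"
    unfolding eq using IH(2) kn by (simp add: sign_compose sign_swap_id)
  moreover have "g (Suc k) permutes {0..<n}"
    unfolding eq by (rule permutes_compose[OF IH(1) tr])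
  ultimately show ?case by simp
qed

lemma det_reverse_rows:
  fixes f :: "nat \<Rightarrow> nat \<Rightarrow> 'a :: comm_ring_1"
  shows "det (mat n n (\<lambda>(i, j). f (n - 1 - i) j)) =
    (-1) ^ (n div 2) * det (mat n n (\<lambda>(i, j). f i j))"
proof -
  define g where "g = (\<lambda>i. if i < n \<and> (i < n div 2 \<or> n - 1 - i < n div 2) then n - 1 - i else i)"
  have g: "g permutes {0..<n}" "sign g = (-1) ^ (n div 2)"
    using sign_partial_reversal[of "n div 2" n] by (auto simp: g_def)
  \<comment> \<open>For odd \<open>n\<close> the middle index is its own mirror image, so
    \<open>g\<close> is the full reversal.\<close>
  have gi: "g i = n - 1 - i" if "i < n" for i
    using that unfolding g_def by auto
  have "mat n n (\<lambda>(i, j). f (n - 1 - i) j) =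
      mat n n (\<lambda>(i, j). mat n n (\<lambda>(i, j). f i j) $$ (g i, j))"
    by (intro eq_matI) (auto simp: gi)
  then show ?thesis
    using det_permute_rows[OF mat_carrier g(1), of "\<lambda>(i, j). f i j"] g(2) by simp
qed

section \<open>Symmetric products and binomial coefficients modulo \<open>p\<close>\<close>

lemma prod_symmetric:
  fixes f :: "nat \<Rightarrow> 'a :: comm_monoid_mult"
  assumes "\<And>k. k < N \<Longrightarrow> f (N - 1 - k) = f k"
  shows "(\<Prod>k<N. f k) = (\<Prod>k<N div 2. f k)^2 * (if odd N then f (N div 2) else 1)"
proof -
  let ?h = "N div 2"
  have "(\<Prod>k\<in>{N - ?h..<N}. f k) = (\<Prod>k\<in>{..<?h}. f k)"
    by (rule prod.reindex_bij_witness[of _ "\<lambda>k. N - 1 - k" "\<lambda>k. N - 1 - k"])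
       (use assms in auto)
  moreover have "{..<N} = {..<?h} \<union> {?h..<N - ?h} \<union> {N - ?h..<N}" by auto
  moreover have "(\<Prod>k\<in>{?h..<N - ?h}. f k) = (if odd N then f ?h else 1)"
  proof (cases "odd N")
    case True
    then have "N - ?h = Suc ?h" by presburger
    then show ?thesis using True by simp
  next
    case False
    then have "N - ?h = ?h" by presburger
    then show ?thesis using False by simp
  qed
  moreover have "(\<Prod>k\<in>{..<?h} \<union> {?h..<N - ?h} \<union> {N - ?h..<N}. f k) =
      (\<Prod>k\<in>{..<?h}. f k) * (\<Prod>k\<in>{?h..<N - ?h}. f k) * (\<Prod>k\<in>{N - ?h..<N}. f k)"
    by (subst prod.union_disjoint, simp, simp, fastforce, subst prod.union_disjoint) auto
  ultimately show ?thesis by (simp add: power2_eq_square mult_ac)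
qed

text \<open>A division-free form of \<open>C(-6, k) = (-1)^k C(k + 5, 5)\<close>. Induction works by
  absorption: passing to \<open>Suc k\<close> brings in the factor \<open>p - 6 - k\<close>,
  congruent to \<open>-(k + 6)\<close>.\<close>

lemma fact_mult_binomial_cong:
  assumes "k + 5 < p"
  shows "[fact k * (120 * int ((p - 6) choose k)) = fact k * ((-1)^k * (\<Prod>i\<in>{1..5}. int k + i))] (mod int p)"
  using assms
proof (induction k)
  case 0
  have "{1..5::int} = {1,2,3,4,5}" by auto
  then show ?case by simp
next
  case (Suc k)
  have set5: "{1..5::int} = {1,2,3,4,5}" by auto
  have absorb: "int (Suc k) * int ((p - 6) choose Suc k) = (int p - 6 - int k) * int ((p - 6) choose k)"
  proof -
    have "Suc k * ((p - 6) choose Suc k) = (p - 6 - k) * ((p - 6) choose k)"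
      by (metis binomial_absorb_comp binomial_absorption mult.commute)
    then have "int (Suc k * ((p - 6) choose Suc k)) = int ((p - 6 - k) * ((p - 6) choose k))" by simp
    moreover have "int (p - 6 - k) = int p - 6 - int k" using Suc.prems by simp
    ultimately show ?thesis by (simp only: of_nat_mult)
  qed
  have "fact (Suc k) * (120 * int ((p - 6) choose Suc k)) =
      fact k * 120 * (int (Suc k) * int ((p - 6) choose Suc k))"
    by (simp add: algebra_simps)
  also have "\<dots> = (fact k * (120 * int ((p - 6) choose k))) * (int p - 6 - int k)"
    unfolding absorb by simp
  also have "[\<dots> = (fact k * ((-1)^k * (\<Prod>i\<in>{1..5}. int k + i))) * (- 6 - int k)] (mod int p)"
  proof (rule cong_mult)
    show "[int p - 6 - int k = - 6 - int k] (mod int p)" by (simp add: cong_iff_dvd_diff)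
  qed (use Suc in simp)
  also have "(fact k * ((-1)^k * (\<Prod>i\<in>{1..5}. int k + i))) * (- 6 - int k) =
      fact (Suc k) * ((-1)^Suc k * (\<Prod>i\<in>{1..5}. int (Suc k) + i))"
    by (simp add: set5 algebra_simps)
  finally show ?case .
qed

text \<open>As \<open>k < p\<close>, the factor \<open>fact k\<close> is invertible modulo
  \<open>p\<close> and cancels.\<close>

lemma binomial_prime_minus_6_cong:
  assumes "prime p" "k + 5 < p"
  shows "[120 * int ((p - 6) choose k) = (-1)^k * (\<Prod>i\<in>{1..5}. int k + i)] (mod int p)"
proof -
  have "coprime (int p) (fact k)"
  proof -
    have "coprime p (fact k)"
      using assms by (simp add: prime_imp_coprime prime_dvd_fact_iff)
    then show ?thesis by (metis coprime_int_iff of_nat_fact)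
  qed
  then show ?thesis
    using fact_mult_binomial_cong[OF assms(2)]
    by (simp add: cong_mult_lcancel coprime_commute)
qed

text \<open>With \<open>4 * k\<close> congruent to \<open>-11\<close>, the five factors
  \<open>4 * (k + i)\<close> become -7, -3, 1, 5, 9, whose product is
  \<open>15 * 63\<close>.\<close>

lemma central_coefficient_cong:
  assumes "prime p" "p > 7" "4 * k + 11 = p"
  shows "[2 ^ 12 * ((-1) ^ k * (2 * int ((p - 6) choose k))) = 3^2 * 7] (mod int p)"
proof -
  let ?C = "int ((p - 6) choose k)"
  have set5: "{1..5::int} = {1,2,3,4,5}" by auto
  have k4: "[4 * int k + i = i - 11] (mod int p)" for i
    using assms(3) by (auto simp: cong_iff_dvd_diff)
  \<comment> \<open>Here \<open>15 * 2^13 = 4^5 * 120\<close>: one factor 4 goes to each linear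
    factor, and 15 is cancelled at the end.\<close>
  have "15 * (2^12 * ((-1)^k * (2 * ?C))) = (-1)^k * 4^5 * (120 * ?C)" by simp
  also have "[\<dots> = (-1)^k * 4^5 * ((-1)^k * (\<Prod>i\<in>{1..5}. int k + i))] (mod int p)"
    by (intro cong_mult cong_refl binomial_prime_minus_6_cong) (use assms in auto)
  also have "(-1)^k * 4^5 * ((-1)^k * (\<Prod>i\<in>{1..5}. int k + i)) =
      ((-1)^k * (-1)^k) * ((4 * int k + 4) * (4 * int k + 8) * (4 * int k + 12) * (4 * int k + 16) * (4 * int k + 20))"
    unfolding set5 by (simp add: algebra_simps)
  also have "(-1)^k * (-1)^k = (1::int)" by (simp flip: power_mult_distrib)
  also have "[1 * ((4 * int k + 4) * (4 * int k + 8) * (4 * int k + 12) * (4 * int k + 16) * (4 * int k + 20))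
      = 1 * ((4 - 11) * (8 - 11) * (12 - 11) * (16 - 11) * (20 - 11))] (mod int p)"
    by (intro cong_mult cong_refl k4)
  also have "1 * ((4 - 11) * (8 - 11) * (12 - 11) * (16 - 11) * (20 - 11)) = (15 * (3^2 * 7) :: int)"
    by simp
  finally have "[15 * (2^12 * ((-1)^k * (2 * ?C))) = 15 * (3^2 * 7)] (mod int p)" .
  moreover have "coprime 15 (int p)"
  proof -
    have "coprime p 3" "coprime p 5"
      using assms by (auto intro!: primes_coprime)
    then have "coprime p (3 * 5)" by (simp only: coprime_mult_right_iff)
    then have "coprime (int p) (int 15)" by (subst coprime_int_iff) simp
    then show ?thesis by (simp add: coprime_commute)
  qed
  ultimately show ?thesis by (simp only: cong_mult_lcancel)
qed

section \<open>The quadratic characters of 7 and -1\<close>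

text \<open>The nonzero squares modulo 7 are 1, 2, 4, so \<open>p\<close> is a non-residue; both
  primes are 3 modulo 4, so reciprocity flips the sign.\<close>

lemma QuadRes_7:
  assumes "prime p" "p > 7" "p mod 4 = 3" "p mod 7 \<in> {3, 5, 6}"
  shows "QuadRes (int p) 7"
proof -
  have "\<not> QuadRes 7 (int p)"
  proof
    assume "QuadRes 7 (int p)"
    then obtain y where y: "y^2 mod 7 = int p mod 7"
      by (auto simp: QuadRes_def cong_def)
    have "(y mod 7)^2 mod 7 = int (p mod 7)" using y by (simp add: power_mod zmod_int)
    moreover have "y mod 7 \<in> {0..<7}" by simp
    then have "y mod 7 \<in> {0, 1, 2, 3, 4, 5, 6}" by (simp add: atLeastLessThan_iff) presburger
    ultimately show False using assms(4) by auto
  qed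
  moreover have "\<not> [int p = 0] (mod 7)"
    using assms(4) by (auto simp: cong_def zmod_int) presburger+
  ultimately have "Legendre (int p) 7 = -1" by (simp add: Legendre_def)
  moreover have "Legendre (int p) (int 7) * Legendre (int 7) (int p) =
      (-1) ^ ((p - 1) div 2 * ((7 - 1) div 2))"
    using assms by (intro Quadratic_Reciprocity) auto
  moreover have "odd ((p - 1) div 2 * ((7 - 1) div 2))" using assms(3) by simp presburger
  ultimately have "Legendre 7 (int p) = 1" by simp
  then show ?thesis by (simp add: Legendre_def split: if_splits)
qed

lemma QuadRes_minus_1:
  assumes "prime p" "p mod 4 = 1"
  shows "QuadRes (int p) (-1)"
proof -
  have p: "p > 2" using assms prime_ge_2_nat[of p] by (cases "p = 2") auto
  have "even ((p - 1) div 2)" using assms(2) by presburger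
  then have "[Legendre (-1) (int p) = 1] (mod int p)"
    using euler_criterion[OF assms(1) p, of "-1"] by simp
  \<comment> \<open>This rules out the values 0 and -1 of the symbol.\<close>
  moreover have "\<not> int p dvd 1" "\<not> int p dvd 2" using p by (auto dest: zdvd_imp_le)
  ultimately show ?thesis
    by (auto simp: Legendre_def cong_iff_dvd_diff split: if_splits)
qed

section \<open>Factorization of the determinant modulo \<open>p\<close>\<close>

text \<open>Since \<open>x\<close> and \<open>y\<close> are \<open>n\<close>-th roots of unity, the exponents of \<open>x\<close> in the binomial
  expansion can be folded modulo \<open>n\<close>.\<close>

lemma power_add_fold:
  fixes x y :: int
  assumes "[x ^ n = 1] (mod q)" "[y ^ n = 1] (mod q)" "n \<le> m + 1" "m < 2 * n"
  shows "[(x + y) ^ m = (\<Sum>k<n. int ((m choose k) + (m choose (n + k))) * x ^ k * y ^ (m - k))] (mod q)"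
proof -
  let ?f = "\<lambda>k. int (m choose k) * x ^ k * y ^ (m - k)"
  have "(x + y) ^ m = (\<Sum>k\<le>m. ?f k)" by (simp add: binomial_ring)
  also have "\<dots> = (\<Sum>k<n + n. ?f k)"
    using assms(4) by (intro sum.mono_neutral_left) (auto simp: binomial_eq_0)
  also have "\<dots> = (\<Sum>k<n. ?f k) + (\<Sum>k<n. ?f (n + k))"
    using sum.atLeastLessThan_concat[of 0 n "n + n" ?f] sum.shift_bounds_nat_ivl[of ?f 0 n n]
    by (simp add: lessThan_atLeast0 add.commute)
  finally have expand: "(x + y) ^ m = (\<Sum>k<n. ?f k) + (\<Sum>k<n. ?f (n + k))" .
  have "[(\<Sum>k<n. ?f k) + (\<Sum>k<n. ?f (n + k)) =
      (\<Sum>k<n. ?f k) + (\<Sum>k<n. int (m choose (n + k)) * x ^ k * y ^ (m - k))] (mod q)"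
  proof (intro cong_add cong_sum cong_refl)
    fix k
    show "[?f (n + k) = int (m choose (n + k)) * x ^ k * y ^ (m - k)] (mod q)"
    \<comment> \<open>Otherwise the exponent truncates, but the binomial coefficient is 0.\<close>
    proof (cases "n + k \<le> m")
      case True
      have "?f (n + k) = int (m choose (n + k)) * (x ^ n * x ^ k) * (y ^ (m - (n + k)) * 1)"
        by (simp add: power_add)
      \<comment> \<open>Dropping \<open>x ^ n\<close> and inserting \<open>y ^ n\<close> gives the
        same monomial as in the first block.\<close>
      also have "[\<dots> = int (m choose (n + k)) * (1 * x ^ k) * (y ^ (m - (n + k)) * y ^ n)] (mod q)"
        by (intro cong_mult cong_refl assms(1) cong_sym[OF assms(2)])
      also have "y ^ (m - (n + k)) * y ^ n = y ^ (m - k)"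
        using True by (simp flip: power_add)
      finally show ?thesis by simp
    qed (simp add: binomial_eq_0)
  qed
  moreover have "(\<Sum>k<n. ?f k) + (\<Sum>k<n. int (m choose (n + k)) * x ^ k * y ^ (m - k)) =
      (\<Sum>k<n. int ((m choose k) + (m choose (n + k))) * x ^ k * y ^ (m - k))"
    by (simp only: sum.distrib of_nat_add distrib_right)
  ultimately show ?thesis by (simp only: expand)
qed

text \<open>When \<open>d\<close> and all \<open>x j\<close> are squares modulo \<open>q\<close>,
  only the sign and the product of the \<open>c k\<close> remain to be examined.\<close>

lemma det_power_sum_cong:
  fixes x :: "nat \<Rightarrow> int"
  assumes "\<And>i. i < n \<Longrightarrow> [x i ^ n = 1] (mod q)" "[d ^ n = 1] (mod q)" "n \<le> m + 1" "m < 2 * n"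
  defines "c \<equiv> \<lambda>k. int ((m choose k) + (m choose (n + k)))"
  shows "[det (mat n n (\<lambda>(i, j). (x i + d * x j) ^ m)) =
    (-1) ^ (n div 2) * (\<Prod>k<n. c k) * (\<Prod>k<n. d ^ (m - k)) * (\<Prod>j<n. x j ^ (m + 1 - n)) *
    (det (mat n n (\<lambda>(i, k). x i ^ k)))\<^sup>2] (mod q)"
proof -
  let ?V = "mat n n (\<lambda>(i, k). x i ^ k)"
  have "[det (mat n n (\<lambda>(i, j). (x i + d * x j) ^ m)) =
      det (mat n n (\<lambda>(i, j). \<Sum>k<n. (c k * x i ^ k) * (d * x j) ^ (m - k)))] (mod q)"
  proof (rule det_cong)
    fix i j assume ij: "i < n" "j < n"
    have "[d ^ n * x j ^ n = 1 * 1] (mod q)" by (intro cong_mult assms ij)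
    then have "[(d * x j) ^ n = 1] (mod q)" by (simp add: power_mult_distrib)
    from power_add_fold[OF assms(1)[OF ij(1)] this assms(3,4)]
    show "[(x i + d * x j) ^ m = (\<Sum>k<n. (c k * x i ^ k) * (d * x j) ^ (m - k))] (mod q)"
      by (simp add: c_def)
  qed
  also have "det (mat n n (\<lambda>(i, j). \<Sum>k<n. (c k * x i ^ k) * (d * x j) ^ (m - k))) =
      det (mat n n (\<lambda>(i, k). c k * x i ^ k)) * det (mat n n (\<lambda>(k, j). (d * x j) ^ (m - k)))"
    by (rule det_sum_mult)
  also have "det (mat n n (\<lambda>(i, k). c k * x i ^ k)) = (\<Prod>k<n. c k) * det ?V"
    using det_scale_rows_cols[of n "\<lambda>_. 1" "\<lambda>i k. x i ^ k" c] by (simp add: mult.commute)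
  \<comment> \<open>Splitting \<open>m - k = (n - 1 - k) + (m + 1 - n)\<close> pulls out a column
    factor and leaves a reversed Vandermonde matrix.\<close>
  also have "mat n n (\<lambda>(k, j). (d * x j) ^ (m - k)) =
      mat n n (\<lambda>(k, j). d ^ (m - k) * x j ^ (n - 1 - k) * x j ^ (m + 1 - n))"
  proof (intro eq_matI; clarsimp)
    fix k j assume k: "k < n"
    have e: "m - k = (n - Suc k) + (Suc m - n)" using k assms(3) by simp
    have "x j ^ (m - k) = x j ^ (n - Suc k) * x j ^ (Suc m - n)"
      by (subst e) (rule power_add)
    then show "(d * x j) ^ (m - k) = d ^ (m - k) * x j ^ (n - Suc k) * x j ^ (Suc m - n)"
      by (simp add: power_mult_distrib)
  qed
  also have "det \<dots> = (\<Prod>k<n. d ^ (m - k)) * (\<Prod>j<n. x j ^ (m + 1 - n)) *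
      det (mat n n (\<lambda>(k, j). x j ^ (n - 1 - k)))"
    by (rule det_scale_rows_cols)
  also have "det (mat n n (\<lambda>(k, j). x j ^ (n - 1 - k))) = (-1) ^ (n div 2) * det (mat n n (\<lambda>(k, j). x j ^ k))"
    by (rule det_reverse_rows)
  also have "mat n n (\<lambda>(k, j). x j ^ k) = transpose_mat ?V" by (intro eq_matI) auto
  also have "det \<dots> = det ?V" by (intro det_transpose[of _ n]) simp
  finally show ?thesis by (simp add: power2_eq_square mult_ac)
qed

section \<open>The coefficient product and the conclusion\<close>

lemma QuadRes_coefficient_prod:
  assumes "prime p" "p > 7" "p mod 7 \<in> {3, 5, 6}" "p = 2 * n + 1" "m = p - 6"
  shows "QuadRes (int p) ((-1) ^ (n div 2) * (\<Prod>k<n. int ((m choose k) + (m choose (n + k)))))"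
proof -
  define c where "c k = int ((m choose k) + (m choose (n + k)))" for k
  have n5: "n \<ge> 5"
    using prime_gt_7_ge_11[OF assms(1,2)] assms(4) by simp
  have m: "m = 2 * n - 5" using assms by simp
  \<comment> \<open>Since \<open>m - k = n + (n - 5 - k)\<close>, binomial symmetry swaps the two
    summands of \<open>c\<close> between the mirrored indices.\<close>
  have sym: "c (n - 4 - 1 - k) = c k" if "k < n - 4" for k
  proof -
    have "m choose (n - 5 - k) = m choose (n + k)"
      using that n5 binomial_symmetric[of "n - 5 - k" m] by (simp add: m)
    moreover have "m choose (n + (n - 5 - k)) = m choose k"
      using that n5 binomial_symmetric[of k m] by (simp add: m mult_2)
    ultimately show ?thesis by (simp add: c_def)
  qed
  \<comment> \<open>From \<open>k = n - 4\<close> on, \<open>n + k\<close> exceeds \<open>m\<close>,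
    so \<open>c k\<close> is a single binomial coefficient, and \<open>m - k\<close> stays among
    these four indices.\<close>
  have tail: "c (n - 1) = c (n - 4)" "c (n - 2) = c (n - 3)"
    using n5 binomial_symmetric[of "n - 1" m] binomial_symmetric[of "n - 2" m]
    by (simp_all add: c_def m binomial_eq_0)
  obtain N where N: "n = Suc (Suc (Suc (Suc N)))"
    using n5 by (intro that[of "n - 4"]) simp
  then have N': "n - 4 = N" "n - 3 = Suc N" "n - 2 = Suc (Suc N)" "n - 1 = Suc (Suc (Suc N))"
    by simp_all
  have "(\<Prod>k<n. c k) = (\<Prod>k<n - 4. c k) * c (n - 4) * c (n - 3) * c (n - 2) * c (n - 1)"
    unfolding N' by (subst N) (simp only: prod.lessThan_Suc)
  also have "\<dots> = (\<Prod>k<n - 4. c k) * (c (n - 4) * c (n - 3))\<^sup>2"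
    unfolding tail by (simp only: power2_eq_square mult_ac)
  also have "(\<Prod>k<n - 4. c k) =
      (\<Prod>k<(n - 4) div 2. c k)^2 * (if odd (n - 4) then c ((n - 4) div 2) else 1)"
    by (rule prod_symmetric) (rule sym)
  finally have prod: "(\<Prod>k<n. c k) = ((\<Prod>k<(n - 4) div 2. c k) * (c (n - 4) * c (n - 3)))\<^sup>2 *
      (if odd (n - 4) then c ((n - 4) div 2) else 1)"
    by (simp add: power_mult_distrib mult_ac)
  have "QuadRes (int p) ((-1) ^ (n div 2) * (if odd (n - 4) then c ((n - 4) div 2) else 1))"
  proof (cases "odd n")
    case False
    \<comment> \<open>No middle factor here; the sign is a power of the square -1.\<close>
    then have "p mod 4 = 1" using assms(4) by presburger
    then show ?thesis using False n5 QuadRes_power[OF QuadRes_minus_1[OF assms(1)]] by simp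
  next
    case True
    define k where "k = (n - 4) div 2"
    \<comment> \<open>Thus \<open>p = 4 * k + 11\<close>, and \<open>m - k = n + k\<close> makes
      both summands of \<open>c k\<close> equal.\<close>
    have nk: "n = 2 * k + 5" using True n5 unfolding k_def by presburger
    have "m choose (n + k) = m choose k"
      using binomial_symmetric[of k m] by (simp add: m nk)
    then have ck: "c k = 2 * int ((p - 6) choose k)" by (simp add: c_def assms(5))
    \<comment> \<open>\<open>n div 2 = k + 2\<close> has the parity of \<open>k\<close>.\<close>
    have sgn: "(-1) ^ (n div 2) = ((-1) ^ k :: int)" by (simp add: nk)
    have "[2 ^ 12 * ((-1) ^ k * c k) = 3^2 * 7] (mod int p)"
      unfolding ck by (rule central_coefficient_cong) (use assms nk in auto)
    moreover have "QuadRes (int p) (3^2 * 7)"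
      using assms(4) nk by (intro QuadRes_mult QuadRes_power2 QuadRes_7 assms) presburger
    ultimately have "QuadRes (int p) (2 ^ 12 * ((-1) ^ k * c k))"
      using QuadRes_cong cong_sym by blast
    then have "QuadRes (int p) ((2 ^ 6)\<^sup>2 * ((-1) ^ k * c k))" by simp
    moreover have "coprime (2^6) (int p)"
      unfolding coprime_power_left_iff coprime_left_2_iff_odd using assms(4) by simp
    ultimately have "QuadRes (int p) ((-1) ^ k * c k)" using QuadRes_cancel_power2 by blast
    then show ?thesis using True n5 sgn by (simp add: k_def)
  qed
  then show ?thesis
    unfolding c_def[symmetric] prod
    by (subst mult.left_commute) (rule QuadRes_mult[OF QuadRes_power2])
qed

text \<open>Every factor of the product congruent to the determinant is a square modulo
  \<open>p\<close>.\<close>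

lemma QuadRes_T:
  assumes "prime p" "p > 7" "p mod 7 \<in> {3, 5, 6}" "Legendre d (int p) = 1"
  shows "QuadRes (int p) (T ((p - 11) div 2) d p)"
proof -
  define n m where "n = (p - 1) div 2" and "m = p - 6"
  define x :: "nat \<Rightarrow> int" where "x = (\<lambda>i. (int i + 1)\<^sup>2)"
  have "odd p" using assms prime_odd_nat by auto
  then have p: "p = 2 * n + 1" unfolding n_def by presburger
  have n5: "n \<ge> 5" using prime_gt_7_ge_11[OF assms(1,2)] p by simp
  have xn: "[x i ^ n = 1] (mod int p)" if "i < n" for i
  proof -
    have "\<not> p dvd Suc i" using that p by (auto dest: dvd_imp_le)
    then have "[Suc i ^ (p - 1) = 1] (mod p)" by (rule fermat_theorem[OF assms(1)])
    then have "[int (Suc i ^ (p - 1)) = int 1] (mod int p)" by (simp only: cong_int_iff)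
    moreover have "int (Suc i ^ (p - 1)) = x i ^ n"
      by (simp add: p x_def add.commute flip: power_mult)
    ultimately show ?thesis by simp
  qed
  have dn: "[d ^ n = 1] (mod int p)"
    using euler_criterion[of p d] assms by (simp add: cong_sym n_def)
  have "[T ((p - 11) div 2) d p = det (mat n n (\<lambda>(i, j). (x i + d * x j) ^ m))] (mod int p)"
    unfolding T_def Let_def n_def[symmetric]
  proof (rule det_cong)
    fix r s
    let ?z = "(int r + 1)\<^sup>2 + d * (int s + 1)\<^sup>2"
    have "[?z ^ ((p - 11) div 2) * Legendre ?z (int p) = ?z ^ ((p - 11) div 2) * ?z ^ n] (mod int p)"
      unfolding n_def by (intro cong_mult cong_refl euler_criterion) (use assms in auto)
    \<comment> \<open>The exponents add up to \<open>(n - 5) + n = p - 6\<close>.\<close>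
    also have "?z ^ ((p - 11) div 2) * ?z ^ n = (x r + d * x s) ^ m"
      using n5 by (simp add: p m_def x_def flip: power_add)
        (rule arg_cong[where f = "\<lambda>e. _ ^ e"], presburger)
    finally show "[?z ^ ((p - 11) div 2) * Legendre ?z (int p) = (x r + d * x s) ^ m] (mod int p)" .
  qed
  also have "[det (mat n n (\<lambda>(i, j). (x i + d * x j) ^ m)) =
      (-1) ^ (n div 2) * (\<Prod>k<n. int ((m choose k) + (m choose (n + k)))) *
      (\<Prod>k<n. d ^ (m - k)) * (\<Prod>j<n. x j ^ (m + 1 - n)) *
      (det (mat n n (\<lambda>(i, k). x i ^ k)))\<^sup>2] (mod int p)" (is "[_ = ?R] (mod _)")
    by (rule det_power_sum_cong) (use xn dn n5 in \<open>auto simp: m_def p\<close>)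
  finally have T: "[T ((p - 11) div 2) d p = ?R] (mod int p)" .
  have "QuadRes (int p) d"
    using assms(4) by (simp add: Legendre_def split: if_splits)
  moreover have "QuadRes (int p) (x j)" for j
    unfolding x_def by (rule QuadRes_power2)
  ultimately show ?thesis
    by (intro QuadRes_cong[OF cong_sym[OF T]] QuadRes_mult QuadRes_prod QuadRes_power QuadRes_power2
        QuadRes_coefficient_prod[OF assms(1-3) p m_def])
qed

theorem corollary1p2:
  fixes p :: nat and d :: int
  assumes "prime p" and "p > 7"
    and "Legendre d (int p) = 1"
    and "Legendre (T ((p - 11) div 2) d p) (int p) = -1"
  shows "p mod 7 = 1 \<or> p mod 7 = 2 \<or> p mod 7 = 4"
proof (rule ccontr)
  assume not: "\<not> ?thesis"
  have "\<not> 7 dvd p"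
    using primes_dvd_imp_eq[of 7 p] assms(1,2) by auto
  then have "p mod 7 \<noteq> 0" by (meson mod_0_imp_dvd)
  moreover have "p mod 7 < 7" by simp
  \<comment> \<open>These are the non-residues modulo 7.\<close>
  ultimately have "p mod 7 \<in> {3, 5, 6}" using not by simp presburger
  then have "QuadRes (int p) (T ((p - 11) div 2) d p)"
    using assms by (intro QuadRes_T)
  then show False using assms(4) by (simp add: Legendre_def split: if_splits)
qed

end
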